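(* Let $F>2$, let $W=(H,Q)$ be an $X$-periodic roll wave of the inviscid Saint-Venant equations with speed $c$, and let $\Delta(\lambda,\xi)$ be its periodic Evans-Lopatinsky determinant, defined for $\lambda\in\Lambda_0=\{\lambda\in\mathbb{C}:\Re(\lambda)>-\tfrac{F-2}{2\sqrt{H_s}}\}$ and $\xi\in[-\pi/X,\pi/X]$. Then $\lambda=0$ is a root of $\Delta(\cdot,\xi)$ for all $\xi\in[-\pi/X,\pi/X]$. Equivalently, $\Delta$ factors as $$\Delta(\lambda,\xi)=\lambda\,\hat\Delta(\lambda,\xi)$$ for all $\lambda\in\Lambda_0$ and $\xi\in[-\pi/X,\pi/X]$, where $\hat\Delta$ is an analytic function in both $\lambda$ and $\xi$. Moreover, there exist coefficients $\alpha_0$ and $\alpha_1$ (independent of $\lambda,\xi$) such that, as $\lambda\to0$, uniformly in $\xi\in[-\pi/X,\pi/X]$, $$\hat\Delta(\lambda,\xi)=\alpha_0\,\lambda+\frac{e^{i\xi X}-1}{iX}\,\alpha_1+O\big(|\lambda|(|\lambda|+|\xi|)\big).$$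
   Context: Equations. The inviscid Saint-Venant equations are $\partial_t h+\partial_x q=0$, $\partial_t q+\partial_x\big(\tfrac{q^2}{h}+\tfrac{h^2}{2F^2}\big)=h-\tfrac{|q|q}{h^2}$, with Froude number $F$. Roll waves. Fix $F>2$. A roll wave is determined by $H_s>0$ and $H_-$ with $\frac{1+2F+\sqrt{1+4F}}{2F^2}H_s<H_-<H_s$. Put $q_0=H_s^{3/2}/F$, $c=H_s^{1/2}(1+1/F)$, and let $H_+>H_s$ be the unique solution of $\frac{q_0^2}{H_+}+\frac{H_+^2}{2F^2}=\frac{q_0^2}{H_-}+\frac{H_-^2}{2F^2}$. Let $H:[0,X]\to[H_-,H_+]$ be the (increasing) solution of $H'=F^2\,\frac{H^2+(H_s-c^2)H+q_0^2/H_s}{H^2+H_sH+H_s^2}$ with $H(0)=H_-$, where $X>0$ is determined by $H(X)=H_+$, and let $Q=cH-q_0$. The $X$-periodic extension of $(H,Q)|_{(0,X)}$, with shocks at $jX$, $j\in\mathbb{Z}$, is the profile $W$, and $(h,q)(x,t)=(H,Q)(x-ct)$ is the roll wave. Let $x_s\in(0,X)$ be the sonic point, where $H(x_s)=H_s$. Interior eigenvalue equations. For $\lambda\in\mathbb{C}$, consider on $(0,X)$ $$\lambda h+\partial_x(-ch+q)=0,\qquad \lambda q+\partial_x\Big(\big(\tfrac{2Q}{H}-c\big)q+\big(-\tfrac{Q^2}{H^2}+\tfrac{H}{F^2}\big)h\Big)=h-\tfrac{2Q}{H^2}q+\tfrac{2Q^2}{H^3}h.$$ This system is singular at $x_s$.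 For $\lambda\in\Lambda_0$ its space of analytic solutions on the closed cell is one-dimensional; $(h,q)=(h,q)(\cdot;\lambda)$ denotes the analytic solution (depending analytically on $\lambda$) normalized by $$\begin{pmatrix}h\\ q\end{pmatrix}(x_s)=\frac{F-2}{2(F+1)}\sqrt{H_s}\begin{pmatrix}\big(\lambda+\tfrac23\tfrac{F+1}{\sqrt{H_s}}\big)F\\ \lambda\sqrt{H_s}(F-1)+\tfrac23(F+1)^2\end{pmatrix}.$$ Evans-Lopatinsky determinant. With $\{f\}:=f(X^-)-f(0^+)$ and $\{f\}_\xi:=f(X^-)-e^{i\xi X}f(0^+)$, $$\Delta(\lambda,\xi):=\det\begin{pmatrix}\{\lambda H\}&\{-ch+q\}_\xi\\ \{\lambda Q-(H-\tfrac{Q^2}{H^2})\}&\{(-\tfrac{Q^2}{H^2}+\tfrac{H}{F^2})h+(\tfrac{2Q}{H}-c)q\}_\xi\end{pmatrix}.$$ *)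

theory Defs
  imports "HOL-Analysis.Analysis"
begin

section \<open>Analyticity\<close>

text \<open>
  Power series expansions relative to the domain: at an end point of an interval \<open>T\<close>
  the expansion is required on the side of \<open>T\<close> only.
\<close>

definition real_analytic_on :: "(real \<Rightarrow> complex) \<Rightarrow> real set \<Rightarrow> bool"
  where "real_analytic_on f T \<longleftrightarrow>
    (\<forall>x0\<in>T. \<exists>r>0. \<exists>a :: nat \<Rightarrow> complex. \<forall>x\<in>T. dist x x0 < r \<longrightarrow>
       (\<lambda>n. a n * of_real (x - x0) ^ n) sums f x)"

text \<open>
  Joint analyticity in a complex and a real variable; \<open>has_sum\<close> makes the convergence
  of the double series absolute.
\<close>

definition jointly_analytic_on ::
    "(complex \<Rightarrow> real \<Rightarrow> complex) \<Rightarrow> complex set \<Rightarrow> real set \<Rightarrow> bool"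
  where "jointly_analytic_on f S T \<longleftrightarrow>
    (\<forall>z0\<in>S. \<forall>x0\<in>T. \<exists>r>0. \<exists>a :: nat \<Rightarrow> nat \<Rightarrow> complex.
       \<forall>z\<in>S. \<forall>x\<in>T. dist z z0 < r \<longrightarrow> dist x x0 < r \<longrightarrow>
         ((\<lambda>(m, n). a m n * (z - z0) ^ m * of_real (x - x0) ^ n) has_sum f z x) UNIV)"

section \<open>Roll waves of the inviscid Saint-Venant equations\<close>

definition rw_q0 :: "real \<Rightarrow> real \<Rightarrow> real"
  where "rw_q0 F Hs = Hs powr (3/2) / F"

definition rw_speed :: "real \<Rightarrow> real \<Rightarrow> real"
  where "rw_speed F Hs = sqrt Hs * (1 + 1 / F)"

definition rw_Q :: "real \<Rightarrow> real \<Rightarrow> (real \<Rightarrow> real) \<Rightarrow> real \<Rightarrow> real"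
  where "rw_Q F Hs H x = rw_speed F Hs * H x - rw_q0 F Hs"

text \<open>
  The profile is given by its height \<open>H\<close> on one cell \<open>[0,X]\<close>; values of \<open>H\<close> outside the
  cell are irrelevant, the wave itself being the \<open>X\<close>-periodic extension of the restriction
  of \<open>(H, Q)\<close> to \<open>(0,X)\<close>. The parameters \<open>Hm\<close> and \<open>Hp\<close> are the heights on the two sides
  of the shocks.
\<close>

definition roll_wave ::
    "real \<Rightarrow> real \<Rightarrow> real \<Rightarrow> real \<Rightarrow> real \<Rightarrow> (real \<Rightarrow> real) \<Rightarrow> bool"
  where "roll_wave F Hs Hm Hp X H \<longleftrightarrow>
    0 < Hs \<and>
    (1 + 2 * F + sqrt (1 + 4 * F)) / (2 * F\<^sup>2) * Hs < Hm \<and> Hm < Hs \<and>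
    Hs < Hp \<and>
    (rw_q0 F Hs)\<^sup>2 / Hp + Hp\<^sup>2 / (2 * F\<^sup>2) = (rw_q0 F Hs)\<^sup>2 / Hm + Hm\<^sup>2 / (2 * F\<^sup>2) \<and>
    0 < X \<and>
    H \<in> {0..X} \<rightarrow> {Hm..Hp} \<and>
    H 0 = Hm \<and> H X = Hp \<and>
    (\<forall>x\<in>{0..X}.
       (H has_real_derivative
          F\<^sup>2 * (((H x)\<^sup>2 + (Hs - (rw_speed F Hs)\<^sup>2) * H x + (rw_q0 F Hs)\<^sup>2 / Hs) /
                ((H x)\<^sup>2 + Hs * H x + Hs\<^sup>2)))
       (at x within {0..X}))"

section \<open>Interior eigenvalue equations\<close>

definition Lambda0 :: "real \<Rightarrow> real \<Rightarrow> complex set"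
  where "Lambda0 F Hs = {lam. Re lam > - ((F - 2) / (2 * sqrt Hs))}"

text \<open>The two components of the linearized flux in the frame of the wave.\<close>

definition mass_flux ::
    "real \<Rightarrow> real \<Rightarrow> (real \<Rightarrow> complex) \<Rightarrow> (real \<Rightarrow> complex) \<Rightarrow> real \<Rightarrow> complex"
  where "mass_flux F Hs h q x = - (of_real (rw_speed F Hs) * h x) + q x"

definition momentum_flux ::
    "real \<Rightarrow> real \<Rightarrow> (real \<Rightarrow> real) \<Rightarrow> (real \<Rightarrow> complex) \<Rightarrow> (real \<Rightarrow> complex) \<Rightarrow> real \<Rightarrow> complex"
  where "momentum_flux F Hs H h q x =
    of_real (2 * rw_Q F Hs H x / H x - rw_speed F Hs) * q x +
    of_real (- ((rw_Q F Hs H x)\<^sup>2 / (H x)\<^sup>2) + H x / F\<^sup>2) * h x"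

definition eigenvalue_equations ::
    "real \<Rightarrow> real \<Rightarrow> real \<Rightarrow> (real \<Rightarrow> real) \<Rightarrow> complex \<Rightarrow>
     (real \<Rightarrow> complex) \<Rightarrow> (real \<Rightarrow> complex) \<Rightarrow> bool"
  where "eigenvalue_equations F Hs X H lam h q \<longleftrightarrow>
    (\<forall>x\<in>{0<..<X}. \<exists>dA dB.
       (mass_flux F Hs h q has_vector_derivative dA) (at x) \<and>
       (momentum_flux F Hs H h q has_vector_derivative dB) (at x) \<and>
       lam * h x + dA = 0 \<and>
       lam * q x + dB =
         h x - of_real (2 * rw_Q F Hs H x / (H x)\<^sup>2) * q x
             + of_real (2 * (rw_Q F Hs H x)\<^sup>2 / (H x) ^ 3) * h x)"

text \<open>\<open>xs\<close> is the sonic point, where the system is singular.\<close>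

definition normalized_analytic_solution ::
    "real \<Rightarrow> real \<Rightarrow> real \<Rightarrow> (real \<Rightarrow> real) \<Rightarrow> real \<Rightarrow> complex \<Rightarrow>
     (real \<Rightarrow> complex) \<Rightarrow> (real \<Rightarrow> complex) \<Rightarrow> bool"
  where "normalized_analytic_solution F Hs X H xs lam h q \<longleftrightarrow>
    real_analytic_on h {0..X} \<and> real_analytic_on q {0..X} \<and>
    eigenvalue_equations F Hs X H lam h q \<and>
    h xs = of_real ((F - 2) / (2 * (F + 1)) * sqrt Hs) *
             ((lam + of_real (2/3 * ((F + 1) / sqrt Hs))) * of_real F) \<and>
    q xs = of_real ((F - 2) / (2 * (F + 1)) * sqrt Hs) *
             (lam * of_real (sqrt Hs * (F - 1)) + of_real (2/3 * (F + 1)\<^sup>2))"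

section \<open>The periodic Evans-Lopatinsky determinant\<close>

definition jump :: "real \<Rightarrow> (real \<Rightarrow> complex) \<Rightarrow> complex"
  where "jump X f = Lim (at_left X) f - Lim (at_right 0) f"

definition bloch_jump :: "real \<Rightarrow> real \<Rightarrow> (real \<Rightarrow> complex) \<Rightarrow> complex"
  where "bloch_jump X \<xi> f =
    Lim (at_left X) f - exp (\<i> * of_real (\<xi> * X)) * Lim (at_right 0) f"

definition evans_lopatinsky ::
    "real \<Rightarrow> real \<Rightarrow> real \<Rightarrow> (real \<Rightarrow> real) \<Rightarrow>
     (complex \<Rightarrow> real \<Rightarrow> complex) \<Rightarrow> (complex \<Rightarrow> real \<Rightarrow> complex) \<Rightarrow>
     complex \<Rightarrow> real \<Rightarrow> complex"
  where "evans_lopatinsky F Hs X H h q lam \<xi> =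
    det (vector
      [vector
         [jump X (\<lambda>x. lam * of_real (H x)),
          bloch_jump X \<xi> (mass_flux F Hs (h lam) (q lam))],
       vector
         [jump X (\<lambda>x. lam * of_real (rw_Q F Hs H x) -
                        of_real (H x - (rw_Q F Hs H x)\<^sup>2 / (H x)\<^sup>2)),
          bloch_jump X \<xi> (momentum_flux F Hs H (h lam) (q lam))]] :: complex ^ 2 ^ 2)"

end

theory Submission
  imports Defs "HOL-Complex_Analysis.Cauchy_Integral_Formula"
begin

text \<open>
  At \<open>\<lambda> = 0\<close> translation invariance makes \<open>(H', Q')\<close> a solution of the interior equations: its
  mass flux vanishes and its momentum flux is \<open>H - Q\<^sup>2/H\<^sup>2\<close>. It agrees with the normalized solution
  at the sonic point, and it is the only such solution that is continuous there. Hence both mass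
  entries of the determinant vanish at \<open>\<lambda> = 0\<close>, which gives the factor \<open>\<lambda>\<close>. The Bloch parameter enters
  only through \<open>e = exp (i\<xi>X)\<close>, linearly, so \<open>\<Delta>/\<lambda> = A(\<lambda>) + (e - 1) B(\<lambda>)\<close> with \<open>A\<close> and \<open>B\<close> holomorphic.
  For \<open>e = 1\<close> the jump of the mass flux is \<open>-\<lambda>\<integral>h\<close>, whose \<open>\<lambda>\<close>-derivative at \<open>0\<close> is \<open>-\<integral>H'\<close>; at \<open>\<lambda> = 0\<close>
  the two products in \<open>\<Delta>/\<lambda>\<close> then cancel, so \<open>A(0) = 0\<close>. Taylor expansion of \<open>A\<close>
  and \<open>B\<close> at \<open>0\<close> finishes the proof.
\<close>

section \<open>Joint analyticity\<close>

text \<open>Summing first over \<open>y\<close> and then over \<open>x\<close> gives the value.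
  Passing from the iterated sum to the unordered sum over the product needs summability there, which
  comes from the norms.\<close>

lemma has_sum_Times_mult:
  fixes f :: "'a \<Rightarrow> complex" and g :: "'b \<Rightarrow> complex"
  assumes "(\<lambda>x. norm (f x)) summable_on A" "(f has_sum s) A"
    and "(\<lambda>y. norm (g y)) summable_on B" "(g has_sum t) B"
  shows "((\<lambda>(x, y). f x * g y) has_sum s * t) (A \<times> B)"
proof (rule has_sum_SigmaI)
  show "((\<lambda>y. case (x, y) of (x, y) \<Rightarrow> f x * g y) has_sum f x * t) B" for x
    using has_sum_cmult_right[OF assms(4)] by simp
  show "((\<lambda>x. f x * t) has_sum s * t) A"
    by (rule has_sum_cmult_left[OF assms(2)])
  have "(\<lambda>p. norm (case p of (x, y) \<Rightarrow> f x * g y)) summable_on A \<times> B"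
    unfolding Infinite_Sum.abs_summable_on_Sigma_iff
  proof (intro conjI ballI)
    show "(\<lambda>y. norm (case (x, y) of (x, y) \<Rightarrow> f x * g y)) summable_on B" for x
      using summable_on_cmult_right[OF assms(3)] by (simp add: norm_mult)
    show "(\<lambda>x. norm (\<Sum>\<^sub>\<infinity>y\<in>B. norm (case (x, y) of (x, y) \<Rightarrow> f x * g y))) summable_on A"
      using summable_on_cmult_left[OF assms(1)]
      by (simp add: norm_mult infsum_cmult_right' abs_mult infsum_nonneg)
  qed
  then show "(\<lambda>(x, y). f x * g y) summable_on A \<times> B"
    by (rule Infinite_Sum.abs_summable_summable)
qed

text \<open>The Taylor series still converges at \<open>z + \<rho>\<close>, a point strictly farther
  from \<open>z\<close> than \<open>w\<close>, so it converges absolutely at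
  \<open>w\<close>.\<close>

lemma holomorphic_power_series_abs_summable:
  assumes "f holomorphic_on ball z r" "w \<in> ball z r"
  shows "(\<lambda>n. norm ((deriv ^^ n) f z / fact n * (w - z) ^ n)) summable_on UNIV"
    and "((\<lambda>n. (deriv ^^ n) f z / fact n * (w - z) ^ n) has_sum f w) UNIV"
proof -
  define \<rho> where "\<rho> = (dist z w + r) / 2"
  have "0 < r"
    using assms(2) by (auto intro: le_less_trans[OF zero_le_dist])
  then have \<rho>: "dist z w < \<rho>" "\<rho> < r" "0 < \<rho>"
    using assms(2) by (simp_all add: \<rho>_def add_nonneg_pos)
  have "z + of_real \<rho> \<in> ball z r"
    using \<rho> by (simp add: dist_norm)
  from holomorphic_power_series[OF assms(1) this]
  have "summable (\<lambda>n. (deriv ^^ n) f z / fact n * of_real \<rho> ^ n)"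
    by (simp add: sums_iff)
  then have *: "summable (\<lambda>n. norm ((deriv ^^ n) f z / fact n * (w - z) ^ n))"
    by (rule powser_insidea) (use \<rho> in \<open>simp add: dist_norm norm_minus_commute\<close>)
  show "(\<lambda>n. norm ((deriv ^^ n) f z / fact n * (w - z) ^ n)) summable_on UNIV"
    using * by (simp add: summable_on_UNIV_nonneg_real_iff)
  show "((\<lambda>n. (deriv ^^ n) f z / fact n * (w - z) ^ n) has_sum f w) UNIV"
    by (rule norm_summable_imp_has_sum[OF * holomorphic_power_series[OF assms]])
qed

text \<open>The double series is the product of the Taylor series of \<open>f\<close> at
  \<open>z0\<close> and of \<open>g\<close> at \<open>x0\<close>. As \<open>g\<close> is entire, the
  radius only has to keep the ball around \<open>z0\<close> inside \<open>S\<close>.\<close>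

lemma jointly_analytic_on_mult_separate:
  assumes "open S" "f holomorphic_on S" "g holomorphic_on UNIV"
  shows "jointly_analytic_on (\<lambda>z x. f z * g (of_real x)) S T"
  unfolding jointly_analytic_on_def
proof (intro ballI)
  fix z0 x0 assume "z0 \<in> S"
  then obtain r where r: "r > 0" "ball z0 r \<subseteq> S"
    using assms(1) openE by blast
  have f: "f holomorphic_on ball z0 r" and g: "g holomorphic_on ball (of_real x0) r"
    using assms r holomorphic_on_subset by blast+
  show "\<exists>r>0. \<exists>a. \<forall>z\<in>S. \<forall>x\<in>T. dist z z0 < r \<longrightarrow> dist x x0 < r \<longrightarrow>
      ((\<lambda>(m, n). a m n * (z - z0) ^ m * of_real (x - x0) ^ n) has_sum f z * g (of_real x)) UNIV"
  proof (intro exI[of _ r] conjI ballI impI r(1)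
      exI[of _ "\<lambda>m n. (deriv ^^ m) f z0 / fact m * ((deriv ^^ n) g (of_real x0) / fact n)"])
    fix z x assume "dist z z0 < r" "dist x x0 < r"
    then have "z \<in> ball z0 r" "of_real x \<in> ball (of_real x0 :: complex) r"
      by (simp_all add: dist_commute)
    from has_sum_Times_mult[OF holomorphic_power_series_abs_summable[OF f this(1)]
        holomorphic_power_series_abs_summable[OF g this(2)]]
    show "((\<lambda>(m, n). (deriv ^^ m) f z0 / fact m * ((deriv ^^ n) g (of_real x0) / fact n) *
        (z - z0) ^ m * of_real (x - x0) ^ n) has_sum f z * g (of_real x)) UNIV"
      by (simp add: mult_ac)
  qed
qed

lemma jointly_analytic_on_add:
  assumes "jointly_analytic_on f S T" "jointly_analytic_on g S T"
  shows "jointly_analytic_on (\<lambda>z x. f z x + g z x) S T"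
  unfolding jointly_analytic_on_def
proof (intro ballI)
  fix z0 x0 assume z0: "z0 \<in> S" and x0: "x0 \<in> T"
  obtain r a where r: "r > 0" and a: "\<And>z x. z \<in> S \<Longrightarrow> x \<in> T \<Longrightarrow> dist z z0 < r \<Longrightarrow> dist x x0 < r \<Longrightarrow>
      ((\<lambda>(m, n). a m n * (z - z0) ^ m * of_real (x - x0) ^ n) has_sum f z x) UNIV"
    using assms(1) z0 x0 unfolding jointly_analytic_on_def by blast
  obtain s b where s: "s > 0" and b: "\<And>z x. z \<in> S \<Longrightarrow> x \<in> T \<Longrightarrow> dist z z0 < s \<Longrightarrow> dist x x0 < s \<Longrightarrow>
      ((\<lambda>(m, n). b m n * (z - z0) ^ m * of_real (x - x0) ^ n) has_sum g z x) UNIV"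
    using assms(2) z0 x0 unfolding jointly_analytic_on_def by blast
  show "\<exists>r>0. \<exists>a. \<forall>z\<in>S. \<forall>x\<in>T. dist z z0 < r \<longrightarrow> dist x x0 < r \<longrightarrow>
      ((\<lambda>(m, n). a m n * (z - z0) ^ m * of_real (x - x0) ^ n) has_sum f z x + g z x) UNIV"
  proof (intro exI[of _ "min r s"] conjI ballI impI exI[of _ "\<lambda>m n. a m n + b m n"])
    fix z x assume "z \<in> S" "x \<in> T" "dist z z0 < min r s" "dist x x0 < min r s"
    then have "((\<lambda>p. (case p of (m, n) \<Rightarrow> a m n * (z - z0) ^ m * of_real (x - x0) ^ n) +
        (case p of (m, n) \<Rightarrow> b m n * (z - z0) ^ m * of_real (x - x0) ^ n)) has_sum f z x + g z x) UNIV"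
      by (intro has_sum_add a b) auto
    then show "((\<lambda>(m, n). (a m n + b m n) * (z - z0) ^ m * of_real (x - x0) ^ n)
        has_sum f z x + g z x) UNIV"
      by (simp add: case_prod_unfold algebra_simps)
  qed (use r s in auto)
qed

lemma jointly_analytic_on_imp_holomorphic:
  assumes "jointly_analytic_on f S T" "open S" "x0 \<in> T"
  shows "(\<lambda>z. f z x0) holomorphic_on S"
proof (rule holomorphic_onI)
  fix z0 assume z0: "z0 \<in> S"
  obtain r a where r: "r > 0" and a: "\<And>z. z \<in> S \<Longrightarrow> dist z z0 < r \<Longrightarrow>
      ((\<lambda>(m, n). a m n * (z - z0) ^ m * of_real (x0 - x0) ^ n) has_sum f z x0) UNIV"
    using assms(1,3) z0 unfolding jointly_analytic_on_def by (meson dist_self[THEN ord_eq_less_trans])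
  obtain e where e: "e > 0" "ball z0 e \<subseteq> S"
    using assms(2) z0 openE by blast
  have "(\<lambda>z. f z x0) holomorphic_on ball z0 (min r e)"
  proof (rule power_series_holomorphic)
    fix z assume "z \<in> ball z0 (min r e)"
    then have "z \<in> S" "dist z z0 < r"
      using e by (auto simp: dist_commute)
    note a[OF this]
    \<comment> \<open>Since \<open>0 ^ 0 = 1\<close> and all other powers of \<open>0\<close>
      vanish, only the column \<open>n = 0\<close> survives, which is a power series in
      \<open>z - z0\<close>.\<close>
    also have "((\<lambda>(m, n). a m n * (z - z0) ^ m * of_real (x0 - x0) ^ n) has_sum f z x0) UNIV \<longleftrightarrow>
        ((\<lambda>(m, n). a m n * (z - z0) ^ m * of_real (x0 - x0) ^ n) has_sum f z x0)
          ((\<lambda>m. (m, 0)) ` UNIV)"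
      by (rule has_sum_cong_neutral) (auto simp: power_0_left image_iff)
    also have "\<dots> \<longleftrightarrow> ((\<lambda>m. a m 0 * (z - z0) ^ m) has_sum f z x0) UNIV"
      by (subst has_sum_reindex) (auto simp: inj_on_def o_def)
    finally show "(\<lambda>m. a m 0 * (z - z0) ^ m) sums f z x0"
      by (rule has_sum_imp_sums)
  qed
  then have "(\<lambda>z. f z x0) field_differentiable at z0"
    by (rule holomorphic_on_imp_differentiable_at) (use r e in auto)
  then show "(\<lambda>z. f z x0) field_differentiable at z0 within S"
    by (rule field_differentiable_at_within)
qed

text \<open>Weierstrass M-test: absolute convergence at one corner \<open>(z1, x1)\<close> dominates
  the double series on the neighbourhood \<open>N\<close> spanned by that corner, and a uniform
  limit of polynomials is continuous.\<close>

lemma jointly_analytic_on_imp_continuous: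
  assumes "jointly_analytic_on f S {a..b}" "open S" "a < b"
  shows "continuous_on (S \<times> {a..b}) (\<lambda>(z, x). f z x)"
  unfolding continuous_on_eq_continuous_within
proof (safe)
  fix z0 x0 assume z0: "z0 \<in> S" and x0: "x0 \<in> {a..b}"
  obtain r c where r: "r > 0" and c: "\<And>z x. z \<in> S \<Longrightarrow> x \<in> {a..b} \<Longrightarrow> dist z z0 < r \<Longrightarrow> dist x x0 < r \<Longrightarrow>
      ((\<lambda>(m, n). c m n * (z - z0) ^ m * of_real (x - x0) ^ n) has_sum f z x) UNIV"
    using assms(1) z0 x0 unfolding jointly_analytic_on_def by blast
  obtain e where e: "e > 0" "ball z0 e \<subseteq> S"
    using assms(2) z0 openE by blast
  define \<rho> where "\<rho> = min r e / 2"
  have \<rho>: "0 < \<rho>" "\<rho> < r" "\<rho> < e"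
    using r e by (auto simp: \<rho>_def)
  define z1 where "z1 = z0 + of_real \<rho>"
  have z1: "z1 \<in> S" "dist z1 z0 < r"
    using e \<rho> by (auto simp: z1_def dist_norm)
  \<comment> \<open>The expansion is known on \<open>{a..b}\<close> only, so the corner must lie
    there: \<open>x1\<close> is chosen right of \<open>x0\<close> if there is room and left of it
    otherwise, cut off at the end points. Being different from \<open>x0\<close>, it gives
    \<open>N\<close> positive width.\<close>
  obtain x1 where x1: "x1 \<in> {a..b}" "x1 \<noteq> x0" "dist x1 x0 < r"
  proof (cases "x0 < b")
    case True
    show ?thesis
      by (rule that[of "min b (x0 + r / 2)"]) (use True x0 r in \<open>auto simp: dist_norm\<close>)
  next
    case False
    show ?thesis
      by (rule that[of "max a (x0 - r / 2)"]) (use False x0 r assms(3) in \<open>auto simp: dist_norm\<close>)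
  qed
  define N where "N = (ball z0 \<rho> \<times> ball x0 (dist x1 x0)) \<inter> S \<times> {a..b}"
  define M where "M = (\<lambda>(m, n). norm (c m n * (z1 - z0) ^ m * of_real (x1 - x0) ^ n))"
  have "M summable_on UNIV"
    using c[OF z1(1) x1(1) z1(2) x1(3)] unfolding M_def case_prod_unfold
    by (auto simp: summable_on_iff_abs_summable_on_complex[symmetric] summable_on_def)
  then have "uniform_limit N (\<lambda>A y. \<Sum>(m, n)\<in>A. c m n * (fst y - z0) ^ m * of_real (snd y - x0) ^ n)
      (\<lambda>y. f (fst y) (snd y)) (finite_subsets_at_top UNIV)"
  proof (intro Weierstrass_m_test_general')
    fix p y assume "y \<in> N"
    then have "norm (fst y - z0) \<le> \<rho>" "\<bar>snd y - x0\<bar> \<le> \<bar>x1 - x0\<bar>"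
      by (auto simp: N_def dist_norm norm_minus_commute)
    then show "norm (case p of (m, n) \<Rightarrow> c m n * (fst y - z0) ^ m * of_real (snd y - x0) ^ n) \<le> M p"
      using \<rho>(1) unfolding M_def z1_def case_prod_unfold norm_mult norm_power norm_of_real
      by (intro mult_mono power_mono) auto
  next
    fix y assume y: "y \<in> N"
    then have "dist (fst y) z0 < r" "dist (snd y) x0 < r"
      using \<rho> x1(3) by (auto simp: N_def dist_commute)
    with y show "((\<lambda>p. case p of (m, n) \<Rightarrow> c m n * (fst y - z0) ^ m * of_real (snd y - x0) ^ n)
        has_sum f (fst y) (snd y)) UNIV"
      by (intro c) (auto simp: N_def)
  qed
  then have "continuous_on N (\<lambda>y. f (fst y) (snd y))"
    by (rule uniform_limit_theorem[rotated])
       (auto intro!: always_eventually continuous_intros simp: case_prod_unfold)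
  moreover have "(z0, x0) \<in> N"
    using \<rho> x1 z0 x0 by (auto simp: N_def)
  ultimately have "continuous (at (z0, x0) within N) (\<lambda>(z, x). f z x)"
    by (simp add: continuous_on_eq_continuous_within case_prod_unfold)
  moreover have "at (z0, x0) within N = at (z0, x0) within S \<times> {a..b}"
    using \<rho> x1
    by (intro at_within_nhd[where S = "ball z0 \<rho> \<times> ball x0 (dist x1 x0)"]) (auto simp: N_def open_Times)
  ultimately show "continuous (at (z0, x0) within S \<times> {a..b}) (\<lambda>(z, x). f z x)"
    by simp
qed

section \<open>One-sided limits and divided differences\<close>

lemma Lim_at_left_Icc:
  fixes f :: "real \<Rightarrow> 'a :: t2_space"
  assumes "continuous_on {a..b} f" "a < b"
  shows "Lim (at_left b) f = f b"
  by (rule tendsto_Lim) (use assms continuous_on_Icc_at_leftD in auto)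

lemma Lim_at_right_Icc:
  fixes f :: "real \<Rightarrow> 'a :: t2_space"
  assumes "continuous_on {a..b} f" "a < b"
  shows "Lim (at_right a) f = f a"
  by (rule tendsto_Lim) (use assms continuous_on_Icc_at_rightD in auto)

definition divided_difference :: "(complex \<Rightarrow> complex) \<Rightarrow> complex \<Rightarrow> complex \<Rightarrow> complex"
  where "divided_difference f a z = (if z = a then deriv f a else (f z - f a) / (z - a))"

lemma divided_difference_holomorphic:
  assumes "f holomorphic_on S" "open S"
  shows "divided_difference f a holomorphic_on S"
  using pole_lemma_open[OF assms, of a] by (simp add: divided_difference_def[abs_def])

lemma mult_divided_difference: "(z - a) * divided_difference f a z = f z - f a"
  by (simp add: divided_difference_def)

text \<open>The divided difference at \<open>a\<close> is continuous, its singularity being removed,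
  and hence bounded near \<open>a\<close>.\<close>

lemma holomorphic_Lipschitz_at:
  assumes "f holomorphic_on S" "open S" "a \<in> S"
  shows "\<exists>C\<ge>0. \<forall>\<^sub>F z in nhds a. norm (f z - f a) \<le> C * norm (z - a)"
proof -
  define D where "D = divided_difference f a"
  have "continuous_on S D"
    unfolding D_def
    by (intro holomorphic_on_imp_continuous_on divided_difference_holomorphic assms)
  then have "(D \<longlongrightarrow> D a) (nhds a)"
    using assms by (simp add: continuous_on_eq_continuous_at isCont_def tendsto_nhds_iff)
  then have "\<forall>\<^sub>F z in nhds a. dist (D z) (D a) < 1"
    by (rule tendstoD) simp
  then have "\<forall>\<^sub>F z in nhds a. norm (f z - f a) \<le> (norm (D a) + 1) * norm (z - a)"
  proof eventually_elim
    case (elim z)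
    have "norm (D z) \<le> norm (D a) + 1"
      using elim norm_triangle_ineq2[of "D z" "D a"] by (simp add: dist_norm)
    then have "norm (z - a) * norm (D z) \<le> norm (z - a) * (norm (D a) + 1)"
      by (intro mult_left_mono) auto
    also have "norm (z - a) * norm (D z) = norm (f z - f a)"
      unfolding D_def by (metis mult_divided_difference norm_mult)
    finally show ?case
      by (simp add: mult.commute)
  qed
  then show ?thesis
    by (intro exI[of _ "norm (D a) + 1"]) auto
qed

section \<open>Expansion in the two small parameters \<open>z\<close> and
  \<open>\<xi>\<close>\<close>

lemma norm_exp_i_times_minus_1_le: "norm (exp (\<i> * of_real t) - 1) \<le> \<bar>t\<bar>"
  \<comment> \<open>The norm equals \<open>2 * |sin (t / 2)|\<close>.\<close>
  using abs_sin_x_le_abs_x[of "t / 2"] by (simp add: dist_exp_i_1)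

text \<open>Put \<open>e = exp (i\<xi>X) - 1\<close>, \<open>\<alpha>0 = D 0\<close>, which is
  \<open>A'(0)\<close>, and \<open>\<alpha>1 = iX B(0)\<close>. The remainder is then
  \<open>z (D z - D 0) + (B z - B 0) e\<close>. Lipschitz bounds at \<open>0\<close> and
  \<open>norm e \<le> |\<xi>| X\<close> control both terms, uniformly in all real
  \<open>\<xi>\<close>.\<close>

lemma holomorphic_Bloch_expansion:
  assumes "A holomorphic_on S" "B holomorphic_on S" "open S" "0 \<in> S" "A 0 = 0" "X > 0"
  shows "\<exists>\<alpha>0 \<alpha>1 :: complex. \<exists>C :: real. \<forall>\<^sub>F z in nhds 0. \<forall>\<xi>.
      norm (A z + B z * (exp (\<i> * of_real (\<xi> * X)) - 1) -
            (\<alpha>0 * z + (exp (\<i> * of_real (\<xi> * X)) - 1) / (\<i> * of_real X) * \<alpha>1))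
        \<le> C * (norm z * (norm z + \<bar>\<xi>\<bar>))"
proof -
  define D where "D = divided_difference A 0"
  have A: "A z = z * D z" for z
    using mult_divided_difference[of z 0 A] assms(5) by (simp add: D_def)
  have "D holomorphic_on S"
    unfolding D_def by (intro divided_difference_holomorphic assms)
  from holomorphic_Lipschitz_at[OF this assms(3,4)]
  obtain C1 where C1: "C1 \<ge> 0" "\<forall>\<^sub>F z in nhds 0. norm (D z - D 0) \<le> C1 * norm z"
    by auto
  from holomorphic_Lipschitz_at[OF assms(2-4)]
  obtain C2 where C2: "C2 \<ge> 0" "\<forall>\<^sub>F z in nhds 0. norm (B z - B 0) \<le> C2 * norm z"
    by auto
  define C where "C = C1 + C2 * X"
  have "\<forall>\<^sub>F z in nhds 0. \<forall>\<xi>.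
      norm (A z + B z * (exp (\<i> * of_real (\<xi> * X)) - 1) -
            (D 0 * z + (exp (\<i> * of_real (\<xi> * X)) - 1) / (\<i> * of_real X) * (\<i> * of_real X * B 0)))
        \<le> C * (norm z * (norm z + \<bar>\<xi>\<bar>))"
    using C1(2) C2(2)
  proof eventually_elim
    case (elim z)
    show ?case
    proof
      fix \<xi> :: real
      define e where "e = exp (\<i> * of_real (\<xi> * X)) - 1"
      have e: "norm e \<le> \<bar>\<xi>\<bar> * X"
        using norm_exp_i_times_minus_1_le[of "\<xi> * X"] assms(6) by (simp add: e_def abs_mult)
      have "A z + B z * e - (D 0 * z + e / (\<i> * of_real X) * (\<i> * of_real X * B 0)) =
          z * (D z - D 0) + (B z - B 0) * e"
        using assms(6) by (simp add: A algebra_simps)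
      also have "norm \<dots> \<le> norm z * norm (D z - D 0) + norm (B z - B 0) * norm e"
        by (metis norm_mult norm_triangle_ineq)
      also have "\<dots> \<le> norm z * (C1 * norm z) + (C2 * norm z) * (\<bar>\<xi>\<bar> * X)"
        using elim e C2(1) by (intro add_mono mult_mono) auto
      also have "\<dots> \<le> C * (norm z * (norm z + \<bar>\<xi>\<bar>))"
      proof -
        have "C * (norm z * (norm z + \<bar>\<xi>\<bar>)) - (norm z * (C1 * norm z) + (C2 * norm z) * (\<bar>\<xi>\<bar> * X)) =
            C1 * (norm z * \<bar>\<xi>\<bar>) + C2 * X * (norm z * norm z)"
          by (simp add: C_def algebra_simps)
        also have "\<dots> \<ge> 0"
          using C1(1) C2(1) assms(6) by simp
        finally show ?thesis by simp
      qed
      finally show "norm (A z + B z * (exp (\<i> * of_real (\<xi> * X)) - 1) -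
            (D 0 * z + (exp (\<i> * of_real (\<xi> * X)) - 1) / (\<i> * of_real X) * (\<i> * of_real X * B 0)))
          \<le> C * (norm z * (norm z + \<bar>\<xi>\<bar>))"
        unfolding e_def .
    qed
  qed
  then show ?thesis by blast
qed

text \<open>Formally \<open>m z b - m z a\<close> is \<open>-z\<close> times the integral of
  \<open>h z\<close>, so its derivative at \<open>0\<close> is minus the integral of
  \<open>h 0\<close>, of which \<open>K\<close> is a primitive. The mean value inequality for
  \<open>m z + z K\<close>, whose derivative is \<open>-z (h z - h 0)\<close>, takes the place of
  the integral.\<close>

lemma has_field_derivative_increment:
  fixes h m :: "complex \<Rightarrow> real \<Rightarrow> complex" and K :: "real \<Rightarrow> complex"
  assumes "a < b" "open S" "0 \<in> S"
    and h: "continuous_on (S \<times> {a..b}) (\<lambda>(z, x). h z x)"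
    and m: "\<And>z. z \<in> S \<Longrightarrow> continuous_on {a..b} (m z)"
    and m': "\<And>z x. z \<in> S \<Longrightarrow> x \<in> {a<..<b} \<Longrightarrow> (m z has_vector_derivative - (z * h z x)) (at x)"
    and K: "continuous_on {a..b} K"
    and K': "\<And>x. x \<in> {a<..<b} \<Longrightarrow> (K has_vector_derivative h 0 x) (at x)"
  shows "((\<lambda>z. m z b - m z a) has_field_derivative - (K b - K a)) (at 0)"
proof -
  have increment: "norm (m z b - m z a + z * (K b - K a)) \<le> norm z * \<epsilon> * (b - a)"
    if z: "z \<in> S" and \<epsilon>: "\<And>x. x \<in> {a<..<b} \<Longrightarrow> norm (h z x - h 0 x) \<le> \<epsilon>" for z \<epsilon>
  proof -
    have "\<exists>x\<in>{a<..<b}. norm ((m z b + z * K b) - (m z a + z * K a)) \<le>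
        norm ((\<lambda>y. y *\<^sub>R (- (z * h z x) + z * h 0 x)) (b - a))"
    proof (rule mvt_general[OF assms(1)])
      show "continuous_on {a..b} (\<lambda>x. m z x + z * K x)"
        by (intro continuous_intros m K z)
      show "((\<lambda>x. m z x + z * K x) has_derivative (\<lambda>y. y *\<^sub>R (- (z * h z x) + z * h 0 x))) (at x)"
        if "a < x" "x < b" for x
        unfolding has_vector_derivative_def[symmetric]
        by (intro has_vector_derivative_add m' has_vector_derivative_mult_right K' z) (use that in auto)
    qed
    then obtain x where x: "x \<in> {a<..<b}" and le: "norm ((m z b + z * K b) - (m z a + z * K a)) \<le>
        norm ((b - a) *\<^sub>R (- (z * h z x) + z * h 0 x))"
      by blast
    have "(m z b + z * K b) - (m z a + z * K a) = m z b - m z a + z * (K b - K a)"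
      by (simp add: algebra_simps)
    moreover have "norm ((b - a) *\<^sub>R (- (z * h z x) + z * h 0 x)) = norm z * norm (h z x - h 0 x) * (b - a)"
    proof -
      have "- (z * h z x) + z * h 0 x = - (z * (h z x - h 0 x))"
        by (simp add: algebra_simps)
      then show ?thesis
        using assms(1) by (simp add: norm_mult)
    qed
    moreover have "\<dots> \<le> norm z * \<epsilon> * (b - a)"
      using \<epsilon>[OF x] assms(1) by (intro mult_right_mono mult_left_mono) auto
    ultimately show ?thesis
      using le by (metis order_trans)
  qed
  obtain \<rho> where \<rho>: "\<rho> > 0" "cball 0 \<rho> \<subseteq> S"
    using assms(2,3) open_contains_cball by blast
  \<comment> \<open>Compactness makes \<open>h z\<close> tend to \<open>h 0\<close> uniformly over
    the cell as \<open>z\<close> tends to \<open>0\<close>.\<close>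
  have "uniformly_continuous_on (cball 0 \<rho> \<times> {a..b}) (\<lambda>(z, x). h z x)"
    by (rule compact_uniformly_continuous)
       (use \<rho> in \<open>auto intro: continuous_on_subset[OF h] compact_Times\<close>)
  then have unif: "\<exists>d>0. \<forall>z x. norm z < d \<longrightarrow> norm z \<le> \<rho> \<longrightarrow> x \<in> {a..b} \<longrightarrow> norm (h z x - h 0 x) < \<epsilon>"
    if "\<epsilon> > 0" for \<epsilon>
  proof -
    from \<open>uniformly_continuous_on _ _\<close>[unfolded uniformly_continuous_on_def, rule_format, OF that]
    obtain d where "d > 0" and d: "\<forall>p\<in>cball 0 \<rho> \<times> {a..b}. \<forall>p'\<in>cball 0 \<rho> \<times> {a..b}.
        dist p' p < d \<longrightarrow> dist (case p' of (z, x) \<Rightarrow> h z x) (case p of (z, x) \<Rightarrow> h z x) < \<epsilon>"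
      by blast
    have "norm (h z x - h 0 x) < \<epsilon>" if "norm z < d" "norm z \<le> \<rho>" "x \<in> {a..b}" for z x
      using d[rule_format, of "(0, x)" "(z, x)"] that \<rho> by (simp add: dist_Pair_Pair dist_norm)
    with \<open>d > 0\<close> show ?thesis by blast
  qed
  \<comment> \<open>At \<open>z = 0\<close> the bound holds with
    \<open>\<epsilon> = 0\<close>.\<close>
  have m0: "m 0 b - m 0 a = 0"
    using increment[OF assms(3), of 0] by simp
  show ?thesis
    unfolding has_field_derivative_def has_derivative_at_alt
  proof (intro conjI allI impI)
    fix \<epsilon> :: real assume "\<epsilon> > 0"
    then have "\<epsilon> / (b - a) > 0"
      using assms(1) by simp
    from unif[OF this] obtain d where "d > 0" and d: "\<And>z x. norm z < d \<Longrightarrow> norm z \<le> \<rho> \<Longrightarrow> x \<in> {a..b} \<Longrightarrow>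
        norm (h z x - h 0 x) < \<epsilon> / (b - a)"
      by blast
    show "\<exists>d>0. \<forall>z. norm (z - 0) < d \<longrightarrow>
        norm (m z b - m z a - (m 0 b - m 0 a) - - (K b - K a) * (z - 0)) \<le> \<epsilon> * norm (z - 0)"
    proof (intro exI[of _ "min d \<rho>"] conjI allI impI)
      fix z :: complex assume z: "norm (z - 0) < min d \<rho>"
      then have "z \<in> S"
        using \<rho>(2) by (auto simp: subset_iff)
      then have "norm (m z b - m z a + z * (K b - K a)) \<le> norm z * (\<epsilon> / (b - a)) * (b - a)"
        by (rule increment) (rule less_imp_le[OF d], use z in auto)
      also have "\<dots> = \<epsilon> * norm z"
        using assms(1) by simp
      finally show "norm (m z b - m z a - (m 0 b - m 0 a) - - (K b - K a) * (z - 0)) \<le> \<epsilon> * norm (z - 0)"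
        unfolding m0 by (simp add: algebra_simps)
    qed (use \<open>d > 0\<close> \<rho> in auto)
  qed (rule bounded_linear_mult_right)
qed

section \<open>The zero mode\<close>

definition rw_slope :: "real \<Rightarrow> real \<Rightarrow> real \<Rightarrow> real"
  where "rw_slope F Hs y = F\<^sup>2 * ((y\<^sup>2 + (Hs - (rw_speed F Hs)\<^sup>2) * y + (rw_q0 F Hs)\<^sup>2 / Hs) /
    (y\<^sup>2 + Hs * y + Hs\<^sup>2))"

definition rw_source :: "real \<Rightarrow> real \<Rightarrow> real \<Rightarrow> real"
  where "rw_source F Hs y = y - (rw_speed F Hs * y - rw_q0 F Hs)\<^sup>2 / y\<^sup>2"

text \<open>Arranged so that it is visibly the coefficient of \<open>h\<close> on the right of the
  linearized momentum equation when \<open>q = c h\<close>.\<close>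

definition rw_source_deriv :: "real \<Rightarrow> real \<Rightarrow> real \<Rightarrow> real"
  where "rw_source_deriv F Hs y = 1 - 2 * (rw_speed F Hs * y - rw_q0 F Hs) / y\<^sup>2 * rw_speed F Hs
    + 2 * (rw_speed F Hs * y - rw_q0 F Hs)\<^sup>2 / y ^ 3"

text \<open>The derivative of \<open>q0^2 / y + y^2 / (2 F^2)\<close>, the quantity that is equal on
  the two sides of a shock.\<close>

definition rw_flux_coeff :: "real \<Rightarrow> real \<Rightarrow> real \<Rightarrow> real"
  where "rw_flux_coeff F Hs y = y / F\<^sup>2 - (rw_q0 F Hs)\<^sup>2 / y\<^sup>2"

text \<open>Trading the real power for a power of \<open>sqrt Hs\<close> makes the identities below
  rational in \<open>F\<close>, \<open>y\<close> and \<open>sqrt Hs\<close>.\<close>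

lemma rw_q0_eq: "0 \<le> Hs \<Longrightarrow> rw_q0 F Hs = sqrt Hs ^ 3 / F"
proof -
  assume "0 \<le> Hs"
  have "Hs powr (3 / 2) = Hs powr (1 + 1 / 2)"
    by simp
  also have "\<dots> = Hs * sqrt Hs"
    using \<open>0 \<le> Hs\<close> by (simp only: powr_add powr_half_sqrt) simp
  also have "\<dots> = sqrt Hs ^ 3"
    using \<open>0 \<le> Hs\<close> by (simp add: power3_eq_cube)
  finally show ?thesis
    by (simp add: rw_q0_def)
qed

lemma rw_slope_eq:
  assumes "F > 0" "Hs > 0"
  shows "rw_slope F Hs y =
    (F\<^sup>2 * y\<^sup>2 - (2 * F + 1) * Hs * y + Hs\<^sup>2) / (y\<^sup>2 + Hs * y + Hs\<^sup>2)"
proof -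
  define s where "s = sqrt Hs"
  have Hs: "Hs = s\<^sup>2" "s > 0"
    using assms by (auto simp: s_def)
  have "F\<^sup>2 * (y\<^sup>2 + (Hs - (rw_speed F Hs)\<^sup>2) * y + (rw_q0 F Hs)\<^sup>2 / Hs) =
      F\<^sup>2 * y\<^sup>2 - (2 * F + 1) * Hs * y + Hs\<^sup>2"
    using assms unfolding rw_speed_def rw_q0_eq[OF less_imp_le[OF assms(2)]] s_def[symmetric]
    unfolding Hs(1) using Hs(2) by (simp add: field_simps power2_eq_square power3_eq_cube)
  then show ?thesis
    unfolding rw_slope_def by simp
qed

text \<open>The bound on \<open>y\<close> is the larger root of the numerator in
  \<open>rw_slope_eq\<close>; the other root has \<open>- r\<close> in place of \<open>r\<close>.
  Beyond the larger root both linear factors are positive.\<close>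

lemma rw_slope_pos:
  assumes "F > 0" "Hs > 0" "(1 + 2 * F + sqrt (1 + 4 * F)) / (2 * F\<^sup>2) * Hs < y"
  shows "rw_slope F Hs y > 0"
proof -
  define r where "r = sqrt (1 + 4 * F)"
  have r: "r\<^sup>2 = 1 + 4 * F" "r \<ge> 0"
    using assms by (auto simp: r_def)
  have y: "(1 + 2 * F + r) * Hs < 2 * F\<^sup>2 * y"
    using assms by (simp add: r_def field_simps)
  moreover have "(1 + 2 * F - r) * Hs \<le> (1 + 2 * F + r) * Hs"
    using r assms by simp
  ultimately have "0 < (2 * F\<^sup>2 * y - (1 + 2 * F + r) * Hs) * (2 * F\<^sup>2 * y - (1 + 2 * F - r) * Hs)"
    by (intro mult_pos_pos) linarith+
  also have "\<dots> = 4 * F\<^sup>2 * (F\<^sup>2 * y\<^sup>2 - (2 * F + 1) * Hs * y + Hs\<^sup>2)"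
    using r(1) by algebra
  finally have "0 < F\<^sup>2 * y\<^sup>2 - (2 * F + 1) * Hs * y + Hs\<^sup>2"
    using assms(1) by (simp add: zero_less_mult_iff)
  moreover have "0 < (1 + 2 * F + r) * Hs"
    using assms r by simp
  with y have "0 < 2 * F\<^sup>2 * y"
    by linarith
  then have "y > 0"
    using assms(1) by (simp add: zero_less_mult_iff)
  then have "0 < y\<^sup>2 + Hs * y + Hs\<^sup>2"
    using assms(2) by (simp add: add_pos_pos)
  ultimately show ?thesis
    unfolding rw_slope_eq[OF assms(1,2)] by simp
qed

lemma rw_slope_sonic:
  assumes "F > 0" "Hs > 0"
  shows "rw_slope F Hs Hs = F * (F - 2) / 3"
  using assms by (simp add: rw_slope_eq field_simps power2_eq_square)

text \<open>As \<open>q0^2 = Hs^3 / F^2\<close>, the numerator is the difference of cubes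
  \<open>y^3 - Hs^3\<close>. The coefficient thus vanishes only at the sonic height.\<close>

lemma rw_flux_coeff_eq:
  assumes "F > 0" "Hs > 0" "y > 0"
  shows "rw_flux_coeff F Hs y = (y - Hs) * (y\<^sup>2 + Hs * y + Hs\<^sup>2) / (F\<^sup>2 * y\<^sup>2)"
proof -
  define s where "s = sqrt Hs"
  have Hs: "Hs = s\<^sup>2" "s > 0"
    using assms by (auto simp: s_def)
  show ?thesis
    using assms unfolding rw_flux_coeff_def rw_q0_eq[OF less_imp_le[OF assms(2)]] s_def[symmetric]
    unfolding Hs(1) by (simp add: field_simps power2_eq_square power3_eq_cube)
qed

text \<open>This is the profile equation in conservative form:
  \<open>q0^2 / H + H^2 / (2 F^2)\<close> has derivative \<open>H - Q^2 / H^2\<close>. The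
  denominator of the slope cancels the quadratic factor of the coefficient.\<close>

lemma rw_flux_coeff_mult_slope:
  assumes "F > 0" "Hs > 0" "y > 0"
  shows "rw_flux_coeff F Hs y * rw_slope F Hs y = rw_source F Hs y"
proof -
  define s where "s = sqrt Hs"
  have Hs: "Hs = s\<^sup>2" "s > 0"
    using assms by (auto simp: s_def)
  have "0 < y\<^sup>2 + Hs * y + Hs\<^sup>2"
    using assms by (simp add: add_pos_pos)
  then have "rw_flux_coeff F Hs y * rw_slope F Hs y =
      (y - Hs) * (F\<^sup>2 * y\<^sup>2 - (2 * F + 1) * Hs * y + Hs\<^sup>2) / (F\<^sup>2 * y\<^sup>2)"
    unfolding rw_flux_coeff_eq[OF assms] rw_slope_eq[OF assms(1,2)] by simp
  also have "\<dots> = rw_source F Hs y"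
    using assms unfolding rw_source_def rw_speed_def rw_q0_eq[OF less_imp_le[OF assms(2)]] s_def[symmetric]
    unfolding Hs(1) by (simp add: field_simps power2_eq_square power3_eq_cube)
  finally show ?thesis .
qed

lemma rw_source_has_real_derivative:
  assumes "y > 0"
  shows "(rw_source F Hs has_real_derivative rw_source_deriv F Hs y) (at y)"
proof -
  have "((\<lambda>y. y - (c * y - k)\<^sup>2 / y\<^sup>2) has_real_derivative
      1 - (2 * (c * y - k) * c * y\<^sup>2 - (c * y - k)\<^sup>2 * (2 * y)) / (y\<^sup>2 * y\<^sup>2)) (at y)" for c k
    using assms by (auto intro!: derivative_eq_intros)
  moreover have "1 - (2 * u * c * y\<^sup>2 - u\<^sup>2 * (2 * y)) / (y\<^sup>2 * y\<^sup>2) =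
      1 - 2 * u / y\<^sup>2 * c + 2 * u\<^sup>2 / y ^ 3" for u c
    using assms by (simp add: power2_eq_square power3_eq_cube diff_divide_distrib mult_ac)
  ultimately show ?thesis
    unfolding rw_source_def[abs_def] rw_source_deriv_def by (simp only:)
qed

section \<open>Regularity and monotonicity of the profile on the closed cell\<close>

context
  fixes F Hs Hm Hp X :: real and H :: "real \<Rightarrow> real"
  assumes F: "F > 2" and wave: "roll_wave F Hs Hm Hp X H"
begin

lemma roll_wave_Hs_pos: "Hs > 0" and roll_wave_X_pos: "X > 0"
  using wave by (auto simp: roll_wave_def)

lemma roll_wave_endpoints: "H 0 = Hm" "H X = Hp"
  using wave by (auto simp: roll_wave_def)

lemma roll_wave_slope_pos: "x \<in> {0..X} \<Longrightarrow> rw_slope F Hs (H x) > 0"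
  using wave F by (intro rw_slope_pos) (auto simp: roll_wave_def Pi_iff intro: less_le_trans)

lemma roll_wave_pos:
  assumes "x \<in> {0..X}"
  shows "H x > 0"
proof -
  have "0 < (1 + 2 * F + sqrt (1 + 4 * F)) / (2 * F\<^sup>2) * Hs"
    using F roll_wave_Hs_pos by (intro mult_pos_pos divide_pos_pos add_pos_nonneg) auto
  also have "\<dots> < Hm"
    using wave by (simp add: roll_wave_def)
  also have "Hm \<le> H x"
    using wave assms by (auto simp: roll_wave_def Pi_iff)
  finally show ?thesis .
qed

lemma roll_wave_deriv_within:
  "x \<in> {0..X} \<Longrightarrow> (H has_real_derivative rw_slope F Hs (H x)) (at x within {0..X})"
  using wave by (simp add: roll_wave_def rw_slope_def)

lemma roll_wave_deriv:
  "x \<in> {0<..<X} \<Longrightarrow> (H has_real_derivative rw_slope F Hs (H x)) (at x)"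
  using roll_wave_deriv_within[of x] by (simp add: at_within_Icc_at)

lemma roll_wave_continuous: "continuous_on {0..X} H"
  using roll_wave_deriv_within by (rule DERIV_continuous_on)

text \<open>Makes \<open>xs\<close> the only point at height \<open>Hs\<close>, and so the only zero
  of the flux coefficient along the profile.\<close>

lemma roll_wave_strict_mono:
  assumes "x \<in> {0..X}" "y \<in> {0..X}" "x < y"
  shows "H x < H y"
proof (rule DERIV_pos_imp_increasing_open[OF assms(3)])
  show "\<exists>d. (H has_real_derivative d) (at z) \<and> d > 0" if "x < z" "z < y" for z
    using roll_wave_deriv[of z] roll_wave_slope_pos[of z] assms that by auto
  show "continuous_on {x..y} H"
    by (rule continuous_on_subset[OF roll_wave_continuous]) (use assms in auto)
qed

lemma roll_wave_slope_continuous: "continuous_on {0..X} (\<lambda>x. rw_slope F Hs (H x))"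
proof -
  have "(H x)\<^sup>2 + Hs * H x + Hs\<^sup>2 \<noteq> 0" if "x \<in> {0..X}" for x
    using roll_wave_pos[OF that] roll_wave_Hs_pos
    by (intro less_imp_neq[symmetric] add_pos_pos) auto
  then show ?thesis
    unfolding rw_slope_def by (intro continuous_intros roll_wave_continuous) auto
qed

lemma mass_flux_continuous:
  "continuous_on {0..X} h \<Longrightarrow> continuous_on {0..X} q \<Longrightarrow> continuous_on {0..X} (mass_flux F Hs h q)"
  unfolding mass_flux_def[abs_def] by (intro continuous_intros)

lemma rw_Q_continuous: "continuous_on {0..X} (rw_Q F Hs H)"
  unfolding rw_Q_def[abs_def] by (intro continuous_intros roll_wave_continuous)

lemma momentum_flux_continuous:
  "continuous_on {0..X} h \<Longrightarrow> continuous_on {0..X} q \<Longrightarrow>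
    continuous_on {0..X} (momentum_flux F Hs H h q)"
  unfolding momentum_flux_def[abs_def]
  by (intro continuous_intros roll_wave_continuous rw_Q_continuous)
     (use F roll_wave_pos[THEN less_imp_neq] in auto)

lemma rw_source_continuous: "continuous_on {0..X} (\<lambda>x. rw_source F Hs (H x))"
  unfolding rw_source_def
  by (intro continuous_intros roll_wave_continuous) (use roll_wave_pos in fastforce)+

text \<open>With \<open>q = c h\<close> the factor of \<open>h\<close> becomes
  \<open>H / F^2 - (Q / H - c)^2\<close>, and \<open>Q / H - c = - q0 / H\<close>.\<close>

lemma momentum_flux_massless:
  assumes "mass_flux F Hs h q x = 0" "x \<in> {0..X}"
  shows "momentum_flux F Hs H h q x = of_real (rw_flux_coeff F Hs (H x)) * h x"
proof -
  have q: "q x = of_real (rw_speed F Hs) * h x"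
    using assms(1) by (simp add: mass_flux_def)
  have "(2 * rw_Q F Hs H x / H x - rw_speed F Hs) * rw_speed F Hs
      + (- ((rw_Q F Hs H x)\<^sup>2 / (H x)\<^sup>2) + H x / F\<^sup>2) = rw_flux_coeff F Hs (H x)"
    using roll_wave_pos[OF assms(2)]
    by (simp add: rw_Q_def rw_flux_coeff_def field_simps power2_eq_square)
  from arg_cong[OF this, of "\<lambda>t. complex_of_real t * h x"] show ?thesis
    unfolding momentum_flux_def q by (simp add: algebra_simps)
qed

section \<open>Identification of the normalized solution at \<open>\<lambda> = 0\<close>\<close>

context
  fixes xs :: real and h q :: "real \<Rightarrow> complex"
  assumes xs: "xs \<in> {0<..<X}" "H xs = Hs"
    and sol: "normalized_analytic_solution F Hs X H xs 0 h q"
    and cont: "continuous_on {0..X} h" "continuous_on {0..X} q"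
begin

text \<open>At \<open>\<lambda> = 0\<close> the normalization reduces to \<open>h = H'(xs)\<close>,
  in the form given by \<open>rw_slope_sonic\<close>, and \<open>q = c h\<close>.\<close>

lemma zero_mode_sonic: "h xs = of_real (F * (F - 2) / 3)" "mass_flux F Hs h q xs = 0"
proof -
  define s where "s = sqrt Hs"
  have s: "s > 0"
    using roll_wave_Hs_pos by (simp add: s_def)
  \<comment> \<open>Here \<open>g\<close> stands for \<open>F + 1\<close>, kept as an atom so that
    it cancels as a whole.\<close>
  have "(F - 2) / (2 * g) * s * (2/3 * (g / s) * F) = F * (F - 2) / 3" if "g \<noteq> 0" for g
    using s that by (simp add: field_simps)
  from this[of "F + 1"] have "(F - 2) / (2 * (F + 1)) * s * (2/3 * ((F + 1) / s) * F) = F * (F - 2) / 3"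
    using F by linarith
  moreover have "h xs = of_real ((F - 2) / (2 * (F + 1)) * s) *
      ((0 + of_real (2/3 * ((F + 1) / s))) * of_real F)"
    using sol unfolding normalized_analytic_solution_def s_def by blast
  then have "h xs = of_real ((F - 2) / (2 * (F + 1)) * s * (2/3 * ((F + 1) / s) * F))"
    by (simp only: add_0 of_real_mult)
  ultimately show h: "h xs = of_real (F * (F - 2) / 3)"
    by (simp only:)
  have "- (s * (1 + 1 / F) * (F * (F - 2) / 3)) +
      (F - 2) / (2 * g) * s * (2/3 * g\<^sup>2) = 0" if "g = F + 1" "g \<noteq> 0" for g
  proof -
    have "(F - 2) / (2 * g) * s * (2/3 * g\<^sup>2) = (F - 2) * s * g / 3"
      using that(2) by (simp add: power2_eq_square)
    moreover have "s * (1 + 1 / F) * (F * (F - 2) / 3) = (F - 2) * s * g / 3"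
      using F that(1) by (simp add: field_simps)
    ultimately show ?thesis by (simp only: add.left_inverse)
  qed
  from this[of "F + 1"] have "- (s * (1 + 1 / F) * (F * (F - 2) / 3)) +
      (F - 2) / (2 * (F + 1)) * s * (2/3 * (F + 1)\<^sup>2) = 0"
    using F by linarith
  moreover have "q xs = of_real ((F - 2) / (2 * (F + 1)) * s) *
      (0 * of_real (s * (F - 1)) + of_real (2/3 * (F + 1)\<^sup>2))"
    using sol unfolding normalized_analytic_solution_def s_def by blast
  then have "mass_flux F Hs h q xs = of_real (- (s * (1 + 1 / F) * (F * (F - 2) / 3)) +
      (F - 2) / (2 * (F + 1)) * s * (2/3 * (F + 1)\<^sup>2))"
    unfolding mass_flux_def h rw_speed_def s_def[symmetric]
    by (simp only: mult_zero_left add_0 of_real_mult of_real_add of_real_minus)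
  ultimately show "mass_flux F Hs h q xs = 0"
    by (simp only: of_real_0)
qed

text \<open>At \<open>\<lambda> = 0\<close> the mass equation makes the flux constant on the open
  cell, across the sonic point as well. The normalization fixes the constant, and continuity reaches
  the end points.\<close>

lemma zero_mode_mass_flux:
  assumes "x \<in> {0..X}"
  shows "mass_flux F Hs h q x = 0"
proof -
  have "(mass_flux F Hs h q has_vector_derivative 0) (at x within {0<..<X})" if "x \<in> {0<..<X}" for x
  proof -
    have "eigenvalue_equations F Hs X H 0 h q"
      using sol by (simp add: normalized_analytic_solution_def)
    from this[unfolded eigenvalue_equations_def, rule_format, OF that]
    obtain dA where "(mass_flux F Hs h q has_vector_derivative dA) (at x)" "0 * h x + dA = 0"
      by blast
    then show ?thesis
      by (auto intro: has_vector_derivative_at_within)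
  qed
  then obtain k where k: "\<And>x. x \<in> {0<..<X} \<Longrightarrow> mass_flux F Hs h q x = k"
    using has_vector_derivative_zero_constant[OF convex_real_interval(8)] by blast
  have "k = 0"
    using k[OF xs(1)] zero_mode_sonic(2) by simp
  show ?thesis
  proof (rule continuous_constant_on_closure[of "{0<..<X}" "mass_flux F Hs h q"])
    show "continuous_on (closure {0<..<X}) (mass_flux F Hs h q)"
      using roll_wave_X_pos mass_flux_continuous[OF cont] by simp
  qed (use k \<open>k = 0\<close> assms roll_wave_X_pos in simp_all)
qed

text \<open>
  Off the sonic point the momentum flux of the zero mode is proportional to that of
  \<open>(H', Q')\<close>, with constants that may differ on the two sides; continuity and the
  normalization at \<open>xs\<close> make both constants \<open>1\<close>.
\<close>

lemma zero_mode_height: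
  assumes "x \<in> {0..X}"
  shows "h x = of_real (rw_slope F Hs (H x))"
proof -
  \<comment> \<open>The ratio of \<open>h\<close> to \<open>H'\<close> is continuous through
    \<open>xs\<close>, whereas the ratio of the momentum fluxes is \<open>0 / 0\<close>
    there.\<close>
  define k where "k = (\<lambda>x. (1 / rw_slope F Hs (H x)) *\<^sub>R h x)"
  have slope: "rw_slope F Hs (H x) \<noteq> 0" if "x \<in> {0..X}" for x
    using roll_wave_slope_pos[OF that] by simp
  have cont_k: "continuous_on {0..X} k"
    unfolding k_def using slope by (intro continuous_intros roll_wave_slope_continuous cont) auto
  \<comment> \<open>A continuous function on a connected open set whose derivative vanishes off a
    finite set is constant, so both sides of \<open>xs\<close> are treated at once.\<close>
  have "k x = 1" if x: "x \<in> {0<..<X}" for x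
  proof (rule has_derivative_zero_unique_strong_connected[where f = k and S = "{0<..<X}" and K = "{xs}" and c = xs])
    show "continuous_on {0<..<X} k"
      by (rule continuous_on_subset[OF cont_k]) auto
    show "k xs = 1"
    proof -
      have "h xs = of_real (rw_slope F Hs (H xs))"
        using F roll_wave_Hs_pos zero_mode_sonic(1) xs(2) by (simp add: rw_slope_sonic)
      then show ?thesis
        using slope[of xs] xs(1) by (simp add: k_def scaleR_conv_of_real)
    qed
    fix x assume x: "x \<in> {0<..<X} - {xs}"
    have source: "rw_source F Hs (H y) = rw_flux_coeff F Hs (H y) * rw_slope F Hs (H y)"
        "rw_flux_coeff F Hs (H y) \<noteq> 0" if y: "y \<in> {0<..<X} - {xs}" for y
    proof -
      have "H y \<noteq> Hs"
        using roll_wave_strict_mono[of xs y] roll_wave_strict_mono[of y xs] xs y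
        by (cases "xs < y") auto
      moreover have pos: "H y > 0"
        using y by (intro roll_wave_pos) auto
      moreover from pos have "(H y)\<^sup>2 + Hs * H y + Hs\<^sup>2 > 0"
        using roll_wave_Hs_pos by (simp add: add_pos_pos)
      ultimately show "rw_flux_coeff F Hs (H y) \<noteq> 0"
        using F roll_wave_Hs_pos by (simp add: rw_flux_coeff_eq)
      show "rw_source F Hs (H y) = rw_flux_coeff F Hs (H y) * rw_slope F Hs (H y)"
        using F roll_wave_Hs_pos pos by (simp add: rw_flux_coeff_mult_slope)
    qed
    have ne: "rw_source F Hs (H x) \<noteq> 0"
      using source[OF x] slope[of x] x by auto
    have "eigenvalue_equations F Hs X H 0 h q" "x \<in> {0<..<X}"
      using sol x by (simp_all add: normalized_analytic_solution_def)
    from this(1)[unfolded eigenvalue_equations_def, rule_format, OF this(2)]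
    obtain dB where dB: "(momentum_flux F Hs H h q has_vector_derivative dB) (at x)"
      and eq: "0 * q x + dB = h x - of_real (2 * rw_Q F Hs H x / (H x)\<^sup>2) * q x
             + of_real (2 * (rw_Q F Hs H x)\<^sup>2 / (H x) ^ 3) * h x"
      by blast
    have "q x = of_real (rw_speed F Hs) * h x"
      using zero_mode_mass_flux[of x] x by (simp add: mass_flux_def)
    with eq have dB_eq: "dB = rw_source_deriv F Hs (H x) *\<^sub>R h x"
      by (simp add: rw_source_deriv_def rw_Q_def scaleR_conv_of_real algebra_simps)
    have "((\<lambda>x. rw_source F Hs (H x)) has_real_derivative
        rw_source_deriv F Hs (H x) * rw_slope F Hs (H x)) (at x)"
      by (rule DERIV_chain2[OF rw_source_has_real_derivative roll_wave_deriv])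
         (use x roll_wave_pos in auto)
    \<comment> \<open>Off \<open>xs\<close> the momentum flux and the source solve the same scalar
      linear equation \<open>u' = (d / c) u\<close>, with \<open>d\<close> the source derivative and
      \<open>c\<close> the flux coefficient. Their quotient therefore has derivative zero.\<close>
    from DERIV_inverse_fun[OF this ne]
    have "((\<lambda>x. inverse (rw_source F Hs (H x)) *\<^sub>R momentum_flux F Hs H h q x) has_vector_derivative
        inverse (rw_source F Hs (H x)) *\<^sub>R dB +
        - (inverse (rw_source F Hs (H x)) * (rw_source_deriv F Hs (H x) * rw_slope F Hs (H x))
            * inverse (rw_source F Hs (H x))) *\<^sub>R momentum_flux F Hs H h q x) (at x)"
      by (intro has_vector_derivative_scaleR dB) (simp add: power2_eq_square mult_ac)
    also have "inverse (rw_source F Hs (H x)) *\<^sub>R dB +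
        - (inverse (rw_source F Hs (H x)) * (rw_source_deriv F Hs (H x) * rw_slope F Hs (H x))
            * inverse (rw_source F Hs (H x))) *\<^sub>R momentum_flux F Hs H h q x = 0"
    proof -
      have n: "momentum_flux F Hs H h q x = rw_flux_coeff F Hs (H x) *\<^sub>R h x"
        using momentum_flux_massless[OF zero_mode_mass_flux] x by (simp add: scaleR_conv_of_real)
      have inverse_product: "inverse S * d + - (inverse S * (d * V) * inverse S) * c = 0"
        if "S = c * V" "S \<noteq> 0" for S d V c :: real
        using that by (auto simp: field_simps)
      have "inverse (rw_source F Hs (H x)) * rw_source_deriv F Hs (H x) +
          - (inverse (rw_source F Hs (H x)) * (rw_source_deriv F Hs (H x) * rw_slope F Hs (H x))
            * inverse (rw_source F Hs (H x))) * rw_flux_coeff F Hs (H x) = 0"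
        using ne source(1)[OF x] inverse_product by blast
      then show ?thesis
        unfolding n dB_eq scaleR_scaleR scaleR_left_distrib[symmetric] by simp
    qed
    finally have deriv0: "((\<lambda>x. inverse (rw_source F Hs (H x)) *\<^sub>R momentum_flux F Hs H h q x)
        has_vector_derivative 0) (at x)" .
    \<comment> \<open>The flux coefficient is a common factor of momentum flux and source; it
      cancels because it is nonzero off \<open>xs\<close>.\<close>
    have k_eq: "inverse (rw_source F Hs (H y)) *\<^sub>R momentum_flux F Hs H h q y = k y"
      if y: "y \<in> {0<..<X} - {xs}" for y
    proof -
      have "momentum_flux F Hs H h q y = rw_flux_coeff F Hs (H y) *\<^sub>R h y"
        using momentum_flux_massless[OF zero_mode_mass_flux] y by (simp add: scaleR_conv_of_real)
      moreover have "inverse (rw_source F Hs (H y)) * rw_flux_coeff F Hs (H y) = 1 / rw_slope F Hs (H y)"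
        unfolding source(1)[OF y] using source(2)[OF y] by (simp add: inverse_eq_divide)
      ultimately show ?thesis
        by (simp add: k_def)
    qed
    have "(k has_vector_derivative 0) (at x)"
      by (rule has_vector_derivative_transform_within_open[OF deriv0 _ x k_eq]) (auto intro: open_delete)
    then show "(k has_derivative (\<lambda>h. 0)) (at x within {0<..<X})"
      by (auto simp: has_vector_derivative_def intro: has_derivative_at_withinI)
  qed (use xs x in auto)
  then have "k x = 1" if "x \<in> {0..X}"
    using continuous_constant_on_closure[of "{0<..<X}" k 1 x] cont_k roll_wave_X_pos that by simp
  then show ?thesis
    using assms slope[of x] by (simp add: k_def scaleR_conv_of_real field_simps)
qed

lemma zero_mode_momentum_flux:
  assumes "x \<in> {0..X}"
  shows "momentum_flux F Hs H h q x = of_real (rw_source F Hs (H x))"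
proof -
  have "momentum_flux F Hs H h q x = of_real (rw_flux_coeff F Hs (H x) * rw_slope F Hs (H x))"
    unfolding momentum_flux_massless[OF zero_mode_mass_flux[OF assms] assms] zero_mode_height[OF assms]
    by simp
  also have "rw_flux_coeff F Hs (H x) * rw_slope F Hs (H x) = rw_source F Hs (H x)"
    using F roll_wave_Hs_pos roll_wave_pos[OF assms] by (intro rw_flux_coeff_mult_slope) auto
  finally show ?thesis .
qed

end

end

section \<open>The determinant\<close>

text \<open>Continuity on the closed cell turns every one-sided limit in the determinant into an end
  point value.\<close>

lemma evans_lopatinsky_eq:
  assumes "F > 2" "roll_wave F Hs Hm Hp X H"
    and "continuous_on {0..X} (h lam)" "continuous_on {0..X} (q lam)"
  shows "evans_lopatinsky F Hs X H h q lam \<xi> =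
    lam * of_real (Hp - Hm) *
      (momentum_flux F Hs H (h lam) (q lam) X -
       exp (\<i> * of_real (\<xi> * X)) * momentum_flux F Hs H (h lam) (q lam) 0) -
    (mass_flux F Hs (h lam) (q lam) X - exp (\<i> * of_real (\<xi> * X)) * mass_flux F Hs (h lam) (q lam) 0) *
      (lam * of_real (rw_Q F Hs H X - rw_Q F Hs H 0) - of_real (rw_source F Hs Hp - rw_source F Hs Hm))"
proof -
  note wave = assms(1,2)
  note X = roll_wave_X_pos[OF wave]
  note jumps = Lim_at_left_Icc[OF _ X] Lim_at_right_Icc[OF _ X]
  have "jump X (\<lambda>x. lam * of_real (H x)) = lam * of_real (Hp - Hm)"
    unfolding jump_def
    by (subst jumps, intro continuous_intros roll_wave_continuous[OF wave])+
       (simp add: roll_wave_endpoints[OF wave] algebra_simps)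
  moreover have "jump X (\<lambda>x. lam * of_real (rw_Q F Hs H x) -
      of_real (H x - (rw_Q F Hs H x)\<^sup>2 / (H x)\<^sup>2)) =
      lam * of_real (rw_Q F Hs H X - rw_Q F Hs H 0) - of_real (rw_source F Hs Hp - rw_source F Hs Hm)"
  proof -
    have "H x - (rw_Q F Hs H x)\<^sup>2 / (H x)\<^sup>2 = rw_source F Hs (H x)" for x
      by (simp add: rw_Q_def rw_source_def)
    then show ?thesis
      unfolding jump_def
      by (simp only:, (subst jumps,
            intro continuous_intros rw_Q_continuous[OF wave] rw_source_continuous[OF wave])+)
         (simp add: roll_wave_endpoints[OF wave] algebra_simps)
  qed
  ultimately show ?thesis
    unfolding evans_lopatinsky_def det_2 vector_2 bloch_jump_def
      jumps[OF mass_flux_continuous[OF wave assms(3,4)]]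
      jumps[OF momentum_flux_continuous[OF wave assms(3,4)]]
    by simp
qed

theorem proposition1p3:
  fixes F Hs Hm Hp X xs :: real
    and H :: "real \<Rightarrow> real"
    and h q :: "complex \<Rightarrow> real \<Rightarrow> complex"
  assumes "F > 2"
    and "roll_wave F Hs Hm Hp X H"
    and "xs \<in> {0<..<X}" and "H xs = Hs"
    and "\<forall>lam\<in>Lambda0 F Hs. normalized_analytic_solution F Hs X H xs lam (h lam) (q lam)"
    and "jointly_analytic_on h (Lambda0 F Hs) {0..X}"
    and "jointly_analytic_on q (Lambda0 F Hs) {0..X}"
  shows "(\<forall>\<xi>\<in>{- pi / X..pi / X}. evans_lopatinsky F Hs X H h q 0 \<xi> = 0) \<and>
    (\<exists>Dhat :: complex \<Rightarrow> real \<Rightarrow> complex.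
       jointly_analytic_on Dhat (Lambda0 F Hs) {- pi / X..pi / X} \<and>
       (\<forall>lam\<in>Lambda0 F Hs. \<forall>\<xi>\<in>{- pi / X..pi / X}.
          evans_lopatinsky F Hs X H h q lam \<xi> = lam * Dhat lam \<xi>) \<and>
       (\<exists>\<alpha>0 \<alpha>1 :: complex. \<exists>C :: real.
          \<forall>\<^sub>F lam in nhds 0. \<forall>\<xi>\<in>{- pi / X..pi / X}.
            norm (Dhat lam \<xi> -
                  (\<alpha>0 * lam + (exp (\<i> * of_real (\<xi> * X)) - 1) / (\<i> * of_real X) * \<alpha>1))
              \<le> C * (norm lam * (norm lam + \<bar>\<xi>\<bar>))))"
proof -
  note wave = assms(1,2)
  note X = roll_wave_X_pos[OF wave] and Hs = roll_wave_Hs_pos[OF wave]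
  define S where "S = Lambda0 F Hs"
  have S: "open S" "0 \<in> S"
    using Hs assms(1) by (auto simp: S_def Lambda0_def open_halfspace_Re_gt)
  have sol: "normalized_analytic_solution F Hs X H xs z (h z) (q z)" if "z \<in> S" for z
    using assms(5) that by (simp add: S_def)
  have joint: "continuous_on (S \<times> {0..X}) (\<lambda>(z, x). h z x)" "continuous_on (S \<times> {0..X}) (\<lambda>(z, x). q z x)"
    using assms(6,7) S(1) X unfolding S_def by (auto intro: jointly_analytic_on_imp_continuous)
  have cont: "continuous_on {0..X} (h z)" "continuous_on {0..X} (q z)" if "z \<in> S" for z
  proof -
    have "continuous_on {0..X} (\<lambda>x. (z, x))" "(\<lambda>x. (z, x)) ` {0..X} \<subseteq> S \<times> {0..X}"
      using that by (auto intro!: continuous_on_Pair)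
    from continuous_on_compose2[OF joint(1) this] continuous_on_compose2[OF joint(2) this]
    show "continuous_on {0..X} (h z)" "continuous_on {0..X} (q z)"
      by simp_all
  qed
  have hol: "(\<lambda>z. h z x) holomorphic_on S" "(\<lambda>z. q z x) holomorphic_on S" if "x \<in> {0..X}" for x
    using assms(6,7) S(1) that unfolding S_def by (auto intro: jointly_analytic_on_imp_holomorphic)
  define m where "m = (\<lambda>z. mass_flux F Hs (h z) (q z))"
  define n where "n = (\<lambda>z. momentum_flux F Hs H (h z) (q z))"
  have hol_m: "(\<lambda>z. m z x) holomorphic_on S" and hol_n: "(\<lambda>z. n z x) holomorphic_on S"
    if "x \<in> {0..X}" for x
    unfolding m_def n_def mass_flux_def momentum_flux_def
    by (intro holomorphic_intros hol that)+
  note zero_mode = wave assms(3,4) sol[OF S(2)] cont[OF S(2)]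
  have m_zero: "m 0 x = 0" if "x \<in> {0..X}" for x
    unfolding m_def by (rule zero_mode_mass_flux[OF zero_mode that])
  have n_zero: "n 0 x = of_real (rw_source F Hs (H x))" if "x \<in> {0..X}" for x
    unfolding n_def by (rule zero_mode_momentum_flux[OF zero_mode that])
  \<comment> \<open>The mass equation reads \<open>m' = -z h\<close>, and \<open>H\<close> is a
    primitive of \<open>h 0\<close> because the zero mode is \<open>H'\<close>.\<close>
  have m_deriv: "((\<lambda>z. m z X - m z 0) has_field_derivative - (of_real (H X) - of_real (H 0))) (at 0)"
  proof (rule has_field_derivative_increment[OF X S joint(1)])
    show "continuous_on {0..X} (m z)" if "z \<in> S" for z
      unfolding m_def by (rule mass_flux_continuous[OF wave cont[OF that]])
    show "(m z has_vector_derivative - (z * h z x)) (at x)" if z: "z \<in> S" and x: "x \<in> {0<..<X}" for z x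
    proof -
      have "eigenvalue_equations F Hs X H z (h z) (q z)"
        using sol[OF z] by (simp add: normalized_analytic_solution_def)
      from this[unfolded eigenvalue_equations_def, rule_format, OF x]
      obtain dA where "(m z has_vector_derivative dA) (at x)" "z * h z x + dA = 0"
        unfolding m_def by blast
      then show ?thesis
        by (metis add.commute eq_neg_iff_add_eq_0)
    qed
    show "continuous_on {0..X} (\<lambda>x. complex_of_real (H x))"
      by (intro continuous_intros roll_wave_continuous[OF wave])
    show "((\<lambda>x. complex_of_real (H x)) has_vector_derivative h 0 x) (at x)" if x: "x \<in> {0<..<X}" for x
      using zero_mode_height[OF zero_mode, of x] roll_wave_deriv[OF wave x] x
      by (auto intro: has_vector_derivative_of_real)
  qed
  \<comment> \<open>The lower left entry of the determinant.\<close>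
  define J where "J = (\<lambda>z. z * complex_of_real (rw_Q F Hs H X - rw_Q F Hs H 0) -
    of_real (rw_source F Hs Hp - rw_source F Hs Hm))"
  define D where "D = (\<lambda>x. divided_difference (\<lambda>z. m z x) 0)"
  \<comment> \<open>After division by \<open>z\<close>, \<open>A\<close> is the determinant for
    \<open>exp (i\<xi>X) = 1\<close> and \<open>B\<close> is the coefficient of
    \<open>exp (i\<xi>X) - 1\<close>.\<close>
  define A where "A = (\<lambda>z. of_real (Hp - Hm) * (n z X - n z 0) - (D X z - D 0 z) * J z)"
  define B where "B = (\<lambda>z. D 0 z * J z - of_real (Hp - Hm) * n z 0)"
  \<comment> \<open>The factor \<open>1\<close> and the split product in the exponent give each
    summand the shape of a function of \<open>z\<close> times an entire function of
    \<open>of_real \<xi>\<close>.\<close>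
  define Dhat where "Dhat = (\<lambda>z \<xi>. A z * 1 + B z * (exp (\<i> * of_real X * of_real \<xi>) - 1))"
  have ends: "0 \<in> {0..X}" "X \<in> {0..X}"
    using X by auto
  have hol_D: "D x holomorphic_on S" if "x \<in> {0..X}" for x
    unfolding D_def by (intro divided_difference_holomorphic hol_m S that)
  have hol_AB: "A holomorphic_on S" "B holomorphic_on S"
    unfolding A_def B_def J_def
    by (intro holomorphic_intros hol_D hol_n ends)+
  have m_D: "m z x = z * D x z" if "x \<in> {0..X}" for x z
    using mult_divided_difference[of z 0 "\<lambda>z. m z x"] m_zero[OF that] by (simp add: D_def)
  have factor: "evans_lopatinsky F Hs X H h q z \<xi> = z * Dhat z \<xi>" if "z \<in> S" for z \<xi>
  proof -
    have "evans_lopatinsky F Hs X H h q z \<xi> =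
        z * of_real (Hp - Hm) * (n z X - exp (\<i> * of_real (\<xi> * X)) * n z 0) -
        (m z X - exp (\<i> * of_real (\<xi> * X)) * m z 0) * J z"
      unfolding m_def n_def J_def
      by (rule evans_lopatinsky_eq) (rule wave cont that)+
    moreover have "exp (\<i> * of_real X * of_real \<xi>) = exp (\<i> * complex_of_real (\<xi> * X))"
      by (simp add: mult_ac)
    ultimately show ?thesis
      unfolding Dhat_def A_def B_def m_D[OF ends(1)] m_D[OF ends(2)]
      by (simp add: algebra_simps)
  qed
  \<comment> \<open>At \<open>0\<close> the jump of \<open>D\<close> is \<open>-(Hp - Hm)\<close>,
    while the jump of \<open>n\<close> and \<open>- J 0\<close> both equal the jump of the source,
    so the two products cancel.\<close>
  have "A 0 = 0"
  proof -
    have diff: "(\<lambda>z. m z x) field_differentiable at 0" if "x \<in> {0..X}" for x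
      using hol_m[OF that] S by (rule holomorphic_on_imp_differentiable_at)
    have "D X 0 - D 0 0 = deriv (\<lambda>z. m z X - m z 0) 0"
      using diff ends by (simp add: D_def divided_difference_def)
    also have "\<dots> = - of_real (Hp - Hm)"
      using DERIV_imp_deriv[OF m_deriv] by (simp add: roll_wave_endpoints[OF wave])
    finally have D: "D X 0 - D 0 0 = - of_real (Hp - Hm)" .
    have n_jump: "n 0 X - n 0 0 = of_real (rw_source F Hs Hp - rw_source F Hs Hm)"
      using ends by (simp add: n_zero roll_wave_endpoints[OF wave])
    show ?thesis
      unfolding A_def J_def D n_jump by (simp add: algebra_simps)
  qed
  have "jointly_analytic_on Dhat S {- pi / X..pi / X}"
    unfolding Dhat_def
    by (intro jointly_analytic_on_add
        jointly_analytic_on_mult_separate[OF S(1) hol_AB(1), where g = "\<lambda>_. 1"]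
        jointly_analytic_on_mult_separate[OF S(1) hol_AB(2), where g = "\<lambda>w. exp (\<i> * of_real X * w) - 1"]
        holomorphic_intros)
  moreover have "Dhat z \<xi> = A z + B z * (exp (\<i> * of_real (\<xi> * X)) - 1)" for z \<xi>
    by (simp add: Dhat_def mult_ac)
  then have "\<exists>\<alpha>0 \<alpha>1 :: complex. \<exists>C :: real. \<forall>\<^sub>F z in nhds 0. \<forall>\<xi>.
      norm (Dhat z \<xi> - (\<alpha>0 * z + (exp (\<i> * of_real (\<xi> * X)) - 1) / (\<i> * of_real X) * \<alpha>1))
        \<le> C * (norm z * (norm z + \<bar>\<xi>\<bar>))"
    using holomorphic_Bloch_expansion[OF hol_AB S \<open>A 0 = 0\<close> X] by (simp only:)
  then have "\<exists>\<alpha>0 \<alpha>1 :: complex. \<exists>C :: real. \<forall>\<^sub>F z in nhds 0. \<forall>\<xi>\<in>{- pi / X..pi / X}.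
      norm (Dhat z \<xi> - (\<alpha>0 * z + (exp (\<i> * of_real (\<xi> * X)) - 1) / (\<i> * of_real X) * \<alpha>1))
        \<le> C * (norm z * (norm z + \<bar>\<xi>\<bar>))"
    by (elim ex_forward eventually_mono) blast
  moreover have "evans_lopatinsky F Hs X H h q 0 \<xi> = 0" for \<xi>
    using factor[OF S(2)] by simp
  ultimately show ?thesis
    unfolding S_def[symmetric] using factor by blast
qed

end
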